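(* Let $\mathbb X$ be a basic space and $\mathcal D=(D,<,\rho)$ a computable partially ordered set. The following are equivalent: (i) $D$ has a smallest element (w.r.t. $<$); (ii) there exists $\widetilde E:\mathbb N\times\mathbb X\to D$ in $\mathrm{Max}_{\mathrm{Rec}}[\mathbb N\times\mathbb X\to\mathcal D]$ such that $\{\widetilde E_n:n\in\mathbb N\}=\mathrm{Max}_{\mathrm{Rec}}[\mathbb X\to\mathcal D]$, where $\widetilde E_n$ is the partial function $x\mapsto\widetilde E(n,x)$.
   Context: A basic space is a finite non-empty product of sets each of which is $\mathbb N$, $\mathbb Z$, or $A^*$ for some finite alphabet $A$. A computable partially ordered set is a triple $\mathcal D=(D,<,\rho)$ where $\rho:\mathbb N\to D$ is a bijection and $<$ is a strict partial order on $D$ with $\{(m,n):\rho(m)<\rho(n)\}$ computable; a function into $D$ is (total) computable if its composition with $\rho^{-1}$ is. For a basic space $\mathbb Y$ and $f:\mathbb Y\times\mathbb N\to D$ monotone increasing in its second argument, $\max^{\mathcal D}f$ is the partial function on $\mathbb Y$ defined exactly at those $y$ for which $\{f(y,t):t\in\mathbb N\}$ is finite (and non-empty), with value its maximum element. $\mathrm{Max}_{\mathrm{Rec}}[\mathbb Y\to\mathcal D]$ is the class of all $\max^{\mathcal D}f$ with $f:\mathbb Y\times\mathbb N\to D$ total computable and monotone increasing in its second argument. *)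

theory Defs
  imports Main "HOL-Library.Nat_Bijection"
begin

fun prec :: "(nat list \<Rightarrow> nat option) \<Rightarrow> (nat list \<Rightarrow> nat option) \<Rightarrow> nat list \<Rightarrow> nat option" where
  "prec f g [] = None"
| "prec f g (0 # xs) = f xs"
| "prec f g (Suc k # xs) =
     (case prec f g (k # xs) of None \<Rightarrow> None | Some v \<Rightarrow> g (k # v # xs))"

definition mu :: "(nat list \<Rightarrow> nat option) \<Rightarrow> nat list \<Rightarrow> nat option" where
  "mu f xs =
     (if \<exists>k. f (k # xs) = Some 0 \<and> (\<forall>j<k. f (j # xs) \<noteq> None)
      then Some (LEAST k. f (k # xs) = Some 0 \<and> (\<forall>j<k. f (j # xs) \<noteq> None))
      else None)"

definition compose :: "(nat list \<Rightarrow> nat option) \<Rightarrow> (nat list \<Rightarrow> nat option) list \<Rightarrow> nat list \<Rightarrow> nat option" where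
  "compose f gs xs =
     (if \<forall>g\<in>set gs. g xs \<noteq> None then f (map (\<lambda>g. the (g xs)) gs) else None)"

text \<open>recfn n f: f is a partial recursive function of arity n
  (only its behaviour on argument lists of length n matters).\<close>
inductive recfn :: "nat \<Rightarrow> (nat list \<Rightarrow> nat option) \<Rightarrow> bool" where
  rf_zero: "recfn 1 (\<lambda>xs. Some 0)"
| rf_succ: "recfn 1 (\<lambda>xs. Some (Suc (hd xs)))"
| rf_proj: "i < n \<Longrightarrow> recfn n (\<lambda>xs. Some (xs ! i))"
| rf_comp: "recfn m f \<Longrightarrow> length gs = m \<Longrightarrow> (\<forall>g\<in>set gs. recfn n g) \<Longrightarrow> recfn n (compose f gs)"
| rf_prec: "recfn n f \<Longrightarrow> recfn (n + 2) g \<Longrightarrow> recfn (Suc n) (prec f g)"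
| rf_mu: "recfn (Suc n) f \<Longrightarrow> recfn n (mu f)"
| rf_ext: "recfn n f \<Longrightarrow> (\<forall>xs. length xs = n \<longrightarrow> g xs = f xs) \<Longrightarrow> recfn n g"

text \<open>A component of a basic space: N, Z, or A* for the alphabet A = {0..<k}, k \<ge> 1.\<close>
datatype comp = CN | CZ | CW nat

datatype val = VN nat | VZ int | VW "nat list"

fun in_comp :: "comp \<Rightarrow> val \<Rightarrow> bool" where
  "in_comp CN (VN _) = True"
| "in_comp CZ (VZ _) = True"
| "in_comp (CW k) (VW w) = (\<forall>a\<in>set w. a < k)"
| "in_comp _ _ = False"

definition basic_space :: "comp list \<Rightarrow> bool" where
  "basic_space X \<longleftrightarrow> X \<noteq> [] \<and> (\<forall>k. CW k \<in> set X \<longrightarrow> 0 < k)"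

definition bspace :: "comp list \<Rightarrow> val list set" where
  "bspace X = {xs. list_all2 in_comp X xs}"

fun code_val :: "val \<Rightarrow> nat" where
  "code_val (VN n) = prod_encode (0, n)"
| "code_val (VZ i) = prod_encode (1, int_encode i)"
| "code_val (VW w) = prod_encode (2, list_encode w)"

definition code :: "val list \<Rightarrow> nat" where
  "code xs = list_encode (map code_val xs)"

definition comp_on :: "comp list \<Rightarrow> (val list \<Rightarrow> nat) \<Rightarrow> bool" where
  "comp_on X g \<longleftrightarrow> (\<exists>r. recfn 1 r \<and> (\<forall>x\<in>bspace X. r [code x] = Some (g x)))"

definition comp_poset :: "('d \<Rightarrow> 'd \<Rightarrow> bool) \<Rightarrow> (nat \<Rightarrow> 'd) \<Rightarrow> bool" where
  "comp_poset lt \<rho> \<longleftrightarrow>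
     bij \<rho> \<and> (\<forall>d. \<not> lt d d) \<and> (\<forall>a b c. lt a b \<longrightarrow> lt b c \<longrightarrow> lt a c) \<and>
     (\<exists>r. recfn 1 r \<and> (\<forall>m n. r [prod_encode (m, n)] = Some (if lt (\<rho> m) (\<rho> n) then 1 else 0)))"

definition comp_into :: "(nat \<Rightarrow> 'd) \<Rightarrow> comp list \<Rightarrow> (val list \<Rightarrow> 'd) \<Rightarrow> bool" where
  "comp_into \<rho> X f \<longleftrightarrow> (\<exists>g. comp_on X g \<and> (\<forall>x\<in>bspace X. f x = \<rho> (g x)))"

text \<open>f : Y x N -> D, with the pair (y,t) being the tuple y @ [VN t].\<close>
definition mono_last :: "('d \<Rightarrow> 'd \<Rightarrow> bool) \<Rightarrow> comp list \<Rightarrow> (val list \<Rightarrow> 'd) \<Rightarrow> bool" where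
  "mono_last lt Y f \<longleftrightarrow>
     (\<forall>y\<in>bspace Y. \<forall>t t'. t \<le> t' \<longrightarrow>
        f (y @ [VN t]) = f (y @ [VN t']) \<or> lt (f (y @ [VN t])) (f (y @ [VN t'])))"

definition maxf :: "('d \<Rightarrow> 'd \<Rightarrow> bool) \<Rightarrow> comp list \<Rightarrow> (val list \<Rightarrow> 'd) \<Rightarrow> val list \<Rightarrow> 'd option" where
  "maxf lt Y f y =
     (let S = range (\<lambda>t. f (y @ [VN t])) in
      if y \<in> bspace Y \<and> finite S
      then Some (THE m. m \<in> S \<and> (\<forall>s\<in>S. s = m \<or> lt s m))
      else None)"

definition MaxRec :: "('d \<Rightarrow> 'd \<Rightarrow> bool) \<Rightarrow> (nat \<Rightarrow> 'd) \<Rightarrow> comp list \<Rightarrow> (val list \<Rightarrow> 'd option) set" where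
  "MaxRec lt \<rho> Y =
     {maxf lt Y f | f. comp_into \<rho> (Y @ [CN]) f \<and> mono_last lt Y f}"

end

theory Submission
  imports Defs
begin

text \<open>If \<open>b\<close> is a least element, run the \<open>n\<close>-th machine of a universal model on
  \<open>(x, 0), (x, 1), \<dots>\<close> in turn, starting from the value \<open>b\<close> and moving on to the next output as long
  as the outputs increase. This is computable and increasing in the time bound for every \<open>n\<close>, and if the
  machine computes an increasing function \<open>g\<close>, the values taken are those of \<open>g\<close> together with \<open>b\<close>,
  which does not affect the maximum.

  If there is no least element and \<open>E = max f\<close>, let \<open>\<nu>\<close> map the basic space computably onto the
  natural numbers and let \<open>h x\<close> be the first \<open>d\<close> found with \<open>f (\<nu> x, x, 0) \<le> d\<close> false. Then \<open>h\<close>, as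
  the maximum of a sequence constant in time, belongs to the class, but \<open>E (n, x)\<close> lies above
  \<open>f (n, x, 0)\<close> whenever it is defined, so \<open>h\<close> differs from \<open>E\<^sub>n\<close> at any \<open>x\<close> with \<open>\<nu> x = n\<close>.\<close>

section \<open>Total recursive functions\<close>

text \<open>The closure rules below take functions of the whole argument list \<open>xs\<close>, so
  that recursiveness of a composite term follows by backward chaining through its syntax.\<close>

definition trec :: "nat \<Rightarrow> (nat list \<Rightarrow> nat) \<Rightarrow> bool" where
  "trec n F \<longleftrightarrow> recfn n (\<lambda>xs. Some (F xs))"

lemma trec_cong: "trec n F \<Longrightarrow> (\<And>xs. length xs = n \<Longrightarrow> G xs = F xs) \<Longrightarrow> trec n G"
  unfolding trec_def by (erule rf_ext) simp

lemma trec_proj: "i < n \<Longrightarrow> trec n (\<lambda>xs. xs ! i)"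
  unfolding trec_def by (rule rf_proj)

lemma trec_comp:
  assumes "trec (length Gs) F" "\<And>G. G \<in> set Gs \<Longrightarrow> trec n G"
  shows "trec n (\<lambda>xs. F (map (\<lambda>G. G xs) Gs))"
proof -
  have "recfn n (compose (\<lambda>xs. Some (F xs)) (map (\<lambda>G xs. Some (G xs)) Gs))"
    using assms unfolding trec_def by (intro rf_comp[where m = "length Gs"]) auto
  then show ?thesis
    unfolding trec_def by (rule rf_ext) (simp add: compose_def comp_def)
qed

lemma trec_comp1:
  assumes "trec 1 (\<lambda>xs. f (xs ! 0))" "trec n G"
  shows "trec n (\<lambda>xs. f (G xs))"
  using trec_comp[of "[G]" "\<lambda>xs. f (xs ! 0)" n] assms by simp

lemma trec_comp2:
  assumes "trec 2 (\<lambda>xs. f (xs ! 0) (xs ! 1))" "trec n G" "trec n H"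
  shows "trec n (\<lambda>xs. f (G xs) (H xs))"
  using trec_comp[of "[G, H]" "\<lambda>xs. f (xs ! 0) (xs ! 1)" n] assms
  by (auto simp: numeral_2_eq_2)

lemma trec_Suc: "trec n F \<Longrightarrow> trec n (\<lambda>xs. Suc (F xs))"
proof -
  have "trec 1 (\<lambda>xs. Suc (xs ! 0))"
    unfolding trec_def by (rule rf_ext[OF rf_succ]) (auto simp: length_Suc_conv)
  then show "trec n F \<Longrightarrow> ?thesis" by (rule trec_comp1)
qed

text \<open>\<open>rf_zero\<close> has arity 1 only; arity \<open>n\<close> is reached by composing
  it with a projection, which exists for \<open>0 < n\<close>.\<close>

lemma trec_const: "0 < n \<Longrightarrow> trec n (\<lambda>xs. c)"
proof (induction c)
  case 0
  have "trec 1 (\<lambda>xs. 0)" unfolding trec_def by (rule rf_zero)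
  from trec_comp1[OF this trec_proj[OF 0]] show ?case .
qed (rule trec_Suc)

lemma prec_total:
  "prec (\<lambda>xs. Some (F xs)) (\<lambda>xs. Some (G xs)) (k # xs) =
     Some (rec_nat (F xs) (\<lambda>k v. G (k # v # xs)) k)"
  by (induction k) auto

text \<open>One parameter \<open>Y\<close> is enough for the recursions below: several parameters
  are first packed into a pair.\<close>

lemma trec_rec:
  assumes a: "trec 1 (\<lambda>xs. a (xs ! 0))"
    and g: "trec 3 (\<lambda>xs. g (xs ! 0) (xs ! 1) (xs ! 2))"
    and K: "trec n K" and Y: "trec n Y"
  shows "trec n (\<lambda>xs. rec_nat (a (Y xs)) (\<lambda>k v. g k v (Y xs)) (K xs))"
proof -
  have "recfn (1 + 2) (\<lambda>xs. Some (g (xs ! 0) (xs ! 1) (xs ! 2)))"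
    using g by (simp add: trec_def numeral_3_eq_3 numeral_2_eq_2)
  from rf_prec[OF a[unfolded trec_def] this]
  have "recfn 2 (prec (\<lambda>xs. Some (a (xs ! 0))) (\<lambda>xs. Some (g (xs ! 0) (xs ! 1) (xs ! 2))))"
    by (simp add: numeral_2_eq_2)
  then have "trec 2 (\<lambda>xs. rec_nat (a (xs ! 1)) (\<lambda>k v. g k v (xs ! 1)) (xs ! 0))"
    unfolding trec_def
    by (rule rf_ext) (auto simp: numeral_2_eq_2 length_Suc_conv prec_total)
  from trec_comp2[OF this K Y] show ?thesis .
qed

text \<open>For a total \<open>f\<close> the definedness clause of \<open>mu\<close> holds
  trivially, and \<open>ex\<close> makes the search succeed for every parameter.\<close>

lemma trec_Least:
  assumes f: "trec 2 (\<lambda>xs. f (xs ! 0) (xs ! 1))" and ex: "\<And>y. \<exists>k. f k y = 0"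
    and Y: "trec n Y"
  shows "trec n (\<lambda>xs. LEAST k. f k (Y xs) = 0)"
proof -
  have "recfn (Suc 1) (\<lambda>xs. Some (f (xs ! 0) (xs ! 1)))"
    using f by (simp add: trec_def numeral_2_eq_2)
  from rf_mu[OF this] have "trec 1 (\<lambda>xs. LEAST k. f k (xs ! 0) = 0)"
    unfolding trec_def by (rule rf_ext) (simp add: mu_def ex)
  from trec_comp1[OF this Y] show ?thesis .
qed

section \<open>Arithmetic and case distinction\<close>

lemmas trec_basic = trec_proj trec_Suc trec_const

lemma trec_pred: "trec n F \<Longrightarrow> trec n (\<lambda>xs. F xs - 1)"
proof -
  have "rec_nat 0 (\<lambda>k v. k) x = x - 1" for x by (cases x) auto
  moreover have "trec 1 (\<lambda>xs. rec_nat 0 (\<lambda>k v. k) (xs ! 0))"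
    using trec_rec[of "\<lambda>_. 0" "\<lambda>k v y. k" 1 "\<lambda>xs. xs ! 0" "\<lambda>xs. xs ! 0"]
    by (simp add: trec_basic)
  ultimately have "trec 1 (\<lambda>xs. xs ! 0 - 1)" by simp
  then show "trec n F \<Longrightarrow> ?thesis" by (rule trec_comp1)
qed

lemma trec_add: "trec n F \<Longrightarrow> trec n G \<Longrightarrow> trec n (\<lambda>xs. F xs + G xs)"
proof -
  have "rec_nat y (\<lambda>k. Suc) x = x + y" for x y by (induction x) auto
  moreover have "trec 2 (\<lambda>xs. rec_nat (xs ! 1) (\<lambda>k v. Suc v) (xs ! 0))"
    using trec_rec[of "\<lambda>y. y" "\<lambda>k v y. Suc v" 2 "\<lambda>xs. xs ! 0" "\<lambda>xs. xs ! 1"]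
    by (simp add: trec_basic)
  ultimately have "trec 2 (\<lambda>xs. xs ! 0 + xs ! 1)" by simp
  then show "trec n F \<Longrightarrow> trec n G \<Longrightarrow> ?thesis" by (rule trec_comp2)
qed

lemma trec_diff: "trec n F \<Longrightarrow> trec n G \<Longrightarrow> trec n (\<lambda>xs. F xs - G xs)"
proof -
  have "rec_nat y (\<lambda>k v. v - 1) x = y - x" for x y :: nat by (induction x) auto
  moreover have "trec 2 (\<lambda>xs. rec_nat (xs ! 0) (\<lambda>k v. v - 1) (xs ! 1))"
    using trec_rec[of "\<lambda>y. y" "\<lambda>k v y. v - 1" 2 "\<lambda>xs. xs ! 1" "\<lambda>xs. xs ! 0"]
      trec_pred[OF trec_proj[of 1 3]]
    by (simp add: trec_basic)
  ultimately have "trec 2 (\<lambda>xs. xs ! 0 - xs ! 1)" by simp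
  then show "trec n F \<Longrightarrow> trec n G \<Longrightarrow> ?thesis" by (rule trec_comp2)
qed

text \<open>\<open>?d\<close> is the distance of \<open>F\<close> and \<open>G\<close>, so with
  truncated subtraction \<open>1 - ?d\<close> is the 0/1 indicator of equality, which selects
  \<open>A\<close> or \<open>B\<close>.\<close>

lemma trec_if_eq:
  assumes "trec n F" "trec n G" "trec n A" "trec n B"
  shows "trec n (\<lambda>xs. if F xs = G xs then A xs else B xs)"
proof -
  \<comment> \<open>Multiplication by an indicator is a recursion that returns 0 after its first
    step.\<close>
  have mult: "trec 2 (\<lambda>xs. xs ! 0 * (1 - xs ! 1))"
  proof -
    have "rec_nat y (\<lambda>k v. 0) x = y * (1 - x)" for x y :: nat by (cases x) auto
    then show ?thesis
      using trec_rec[of "\<lambda>y. y" "\<lambda>k v y. 0" 2 "\<lambda>xs. xs ! 1" "\<lambda>xs. xs ! 0"]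
      by (simp add: trec_basic)
  qed
  let ?d = "\<lambda>xs. (F xs - G xs) + (G xs - F xs)"
  have d: "trec n ?d" by (intro trec_add trec_diff assms)
  have "trec n (\<lambda>xs. A xs * (1 - ?d xs) + (B xs - B xs * (1 - ?d xs)))"
    by (intro trec_add trec_diff trec_comp2[OF mult] d assms)
  then show ?thesis by (rule trec_cong) auto
qed

section \<open>Pairing and list codes\<close>

definition pfst :: "nat \<Rightarrow> nat" where "pfst z = fst (prod_decode z)"
definition psnd :: "nat \<Rightarrow> nat" where "psnd z = snd (prod_decode z)"
text \<open>Constructor and destructors matching \<open>list_encode\<close>, where 0 codes the empty
  list. Truncation gives \<open>lhd 0 = 0\<close> and \<open>ltl 0 = 0\<close>.\<close>

definition lcons :: "nat \<Rightarrow> nat \<Rightarrow> nat" where "lcons a l = Suc (prod_encode (a, l))"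
definition lhd :: "nat \<Rightarrow> nat" where "lhd l = pfst (l - 1)"
definition ltl :: "nat \<Rightarrow> nat" where "ltl l = psnd (l - 1)"

lemma pfst_encode [simp]: "pfst (prod_encode (a, b)) = a" by (simp add: pfst_def)
lemma psnd_encode [simp]: "psnd (prod_encode (a, b)) = b" by (simp add: psnd_def)
lemma lhd_lcons [simp]: "lhd (lcons a l) = a" by (simp add: lhd_def lcons_def)
lemma ltl_lcons [simp]: "ltl (lcons a l) = l" by (simp add: ltl_def lcons_def)
lemma lcons_neq_0 [simp]: "lcons a l \<noteq> 0" by (simp add: lcons_def)
lemma list_encode_Cons: "list_encode (a # l) = lcons a (list_encode l)" by (simp add: lcons_def)

lemma trec_triangle: "trec n F \<Longrightarrow> trec n (\<lambda>xs. triangle (F xs))"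
proof -
  have "rec_nat 0 (\<lambda>k v. v + Suc k) x = triangle x" for x by (induction x) auto
  moreover have "trec 1 (\<lambda>xs. rec_nat 0 (\<lambda>k v. v + Suc k) (xs ! 0))"
    using trec_rec[of "\<lambda>_. 0" "\<lambda>k v y. v + Suc k" 1 "\<lambda>xs. xs ! 0" "\<lambda>xs. xs ! 0"]
      trec_add[OF trec_proj[of 1 3] trec_Suc[OF trec_proj[of 0 3]]]
    by (simp add: trec_basic)
  ultimately have "trec 1 (\<lambda>xs. triangle (xs ! 0))" by simp
  then show "trec n F \<Longrightarrow> ?thesis" by (rule trec_comp1)
qed

lemma trec_prod_encode:
  "trec n F \<Longrightarrow> trec n G \<Longrightarrow> trec n (\<lambda>xs. prod_encode (F xs, G xs))"
  unfolding prod_encode_def by (simp add: trec_add trec_triangle)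

text \<open>The Cantor diagonal containing \<open>z\<close>, that is the \<open>s\<close> with
  \<open>triangle s \<le> z < triangle (Suc s)\<close>, phrased as a zero search to fit
  \<open>trec_Least\<close>.\<close>

definition pdiag :: "nat \<Rightarrow> nat" where
  "pdiag z = (LEAST s. Suc z - triangle (Suc s) = 0)"

lemma triangle_ge: "n \<le> triangle n"
  by (induction n) auto

lemma pdiag_encode: "pdiag (prod_encode (a, b)) = a + b"
  unfolding pdiag_def
proof (rule Least_equality)
  have mono: "triangle k \<le> triangle l" if "k \<le> l" for k l
    using that by (induction l) (auto simp: le_Suc_eq)
  show "Suc (prod_encode (a, b)) - triangle (Suc (a + b)) = 0"
    by (simp add: prod_encode_def)
  fix s assume s: "Suc (prod_encode (a, b)) - triangle (Suc s) = 0"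
  show "a + b \<le> s"
  proof (rule ccontr)
    assume "\<not> a + b \<le> s"
    then have "triangle (Suc s) \<le> triangle (a + b)" by (intro mono) simp
    with s show False by (simp add: prod_encode_def)
  qed
qed

text \<open>The pairing is \<open>triangle (a + b) + a\<close>: removing the triangle of the
  diagonal leaves \<open>a\<close>, and the diagonal minus \<open>a\<close> is \<open>b\<close>.
  Thus decoding is expressed by operations already known to be recursive.\<close>

lemma pfst_eq: "pfst z = z - triangle (pdiag z)"
  and psnd_eq: "psnd z = pdiag z - pfst z"
proof -
  obtain a b where z: "z = prod_encode (a, b)"
    by (metis prod_decode_inverse surj_pair)
  show "pfst z = z - triangle (pdiag z)" "psnd z = pdiag z - pfst z"
    unfolding z pdiag_encode by (simp_all, simp add: prod_encode_def)
qed

lemma trec_pdiag: "trec n F \<Longrightarrow> trec n (\<lambda>xs. pdiag (F xs))"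
  unfolding pdiag_def
proof (rule trec_Least[of "\<lambda>s z. Suc z - triangle (Suc s)"])
  show "trec 2 (\<lambda>xs. Suc (xs ! 1) - triangle (Suc (xs ! 0)))"
    by (intro trec_diff trec_triangle trec_basic) auto
  show "\<exists>s. Suc y - triangle (Suc s) = 0" for y
    using triangle_ge[of "Suc y"] by (intro exI[of _ y]) simp
qed

lemma trec_pfst: "trec n F \<Longrightarrow> trec n (\<lambda>xs. pfst (F xs))"
  unfolding pfst_eq by (intro trec_diff trec_triangle trec_pdiag)

lemma trec_psnd: "trec n F \<Longrightarrow> trec n (\<lambda>xs. psnd (F xs))"
  unfolding psnd_eq by (intro trec_diff trec_pdiag trec_pfst)

lemma trec_lcons: "trec n F \<Longrightarrow> trec n G \<Longrightarrow> trec n (\<lambda>xs. lcons (F xs) (G xs))"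
  unfolding lcons_def by (intro trec_Suc trec_prod_encode)

lemma trec_lhd: "trec n F \<Longrightarrow> trec n (\<lambda>xs. lhd (F xs))"
  unfolding lhd_def by (intro trec_pfst trec_pred)

lemma trec_ltl: "trec n F \<Longrightarrow> trec n (\<lambda>xs. ltl (F xs))"
  unfolding ltl_def by (intro trec_psnd trec_pred)

lemmas trec_intros = trec_basic trec_pred trec_add trec_diff trec_if_eq trec_prod_encode
  trec_pfst trec_psnd trec_lcons trec_lhd trec_ltl

lemma trec_funpow:
  assumes f: "trec 1 (\<lambda>xs. f (xs ! 0))" and "trec n K" "trec n Y"
  shows "trec n (\<lambda>xs. (f ^^ K xs) (Y xs))"
proof -
  have "(f ^^ k) y = rec_nat y (\<lambda>_. f) k" for k y by (induction k) auto
  then show ?thesis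
    using trec_rec[of "\<lambda>y. y" "\<lambda>k v y. f v", OF _ _ assms(2,3)]
      trec_comp1[OF f trec_proj[of 1 3]]
    by (simp add: trec_basic)
qed

section \<open>A universal machine\<close>

text \<open>A configuration is a pair of a stack of instructions and a current value; an instruction
  is a pair of a tag and an argument. Tags 8 and 9 occur only on the stack, while tag 6 evaluates
  two programs on the same value. Unknown tags act as the identity.\<close>

definition mstep :: "nat \<Rightarrow> nat" where
  "mstep c = (let x = psnd c; i = lhd (pfst c); R = ltl (pfst c); g = pfst i; a = psnd i in
     if pfst c = 0 then c
     else if g = 0 then prod_encode (R, 0)
     else if g = 1 then prod_encode (R, Suc x)
     else if g = 2 then prod_encode (R, x - 1)
     else if g = 3 then prod_encode (R, pfst x)
     else if g = 4 then prod_encode (R, psnd x)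
     else if g = 5 then prod_encode (lcons (pfst a) (lcons (psnd a) R), x)
     else if g = 6 then
       prod_encode (lcons (pfst a) (lcons (prod_encode (8, prod_encode (psnd a, x))) R), x)
     else if g = 7 then
       (if pfst x = 0 then prod_encode (R, x) else prod_encode (lcons a (lcons i R), x))
     else if g = 8 then prod_encode (lcons (pfst a) (lcons (prod_encode (9, x)) R), psnd a)
     else if g = 9 then prod_encode (R, prod_encode (a, x))
     else prod_encode (R, x))"

lemma trec_mstep: "trec n F \<Longrightarrow> trec n (\<lambda>xs. mstep (F xs))"
proof -
  have "trec 1 (\<lambda>xs. mstep (xs ! 0))"
    unfolding mstep_def Let_def by (intro trec_intros) simp_all
  then show "trec n F \<Longrightarrow> ?thesis" by (rule trec_comp1)
qed

text \<open>Quantifying over the remaining stack \<open>R\<close> makes the notion compositional: a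
  program can be run in front of any continuation.\<close>

definition runs :: "nat \<Rightarrow> nat \<Rightarrow> nat \<Rightarrow> bool" where
  "runs p x v \<longleftrightarrow> (\<forall>R. \<exists>t. (mstep ^^ t) (prod_encode (lcons p R, x)) = prod_encode (R, v))"

lemma runs_by_step:
  assumes "\<And>R. \<exists>t. (mstep ^^ t) (mstep (prod_encode (lcons p R, x))) = prod_encode (R, v)"
  shows "runs p x v"
  unfolding runs_def using assms by (metis funpow_simps_right(2) o_apply)

text \<open>Used backwards, it executes the top program and leaves the goal for the rest of the
  stack.\<close>

lemma runs_trans:
  assumes "runs p x y" "\<exists>t. (mstep ^^ t) (prod_encode (R, y)) = c"
  shows "\<exists>t. (mstep ^^ t) (prod_encode (lcons p R, x)) = c"
  using assms unfolding runs_def by (metis funpow_add o_apply)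

lemma steps_0: "\<exists>t. (mstep ^^ t) c = c"
  by (rule exI[of _ 0]) simp

lemma steps_Suc: "\<exists>t. (mstep ^^ t) (mstep c) = d \<Longrightarrow> \<exists>t. (mstep ^^ t) c = d"
  by (metis funpow_simps_right(2) o_apply)

text \<open>Tag 10 has no clause of its own in \<open>mstep\<close> and falls through to the
  identity.\<close>

lemma runs_basic:
  "runs (prod_encode (0, 0)) x 0"
  "runs (prod_encode (1, 0)) x (Suc x)"
  "runs (prod_encode (2, 0)) x (x - 1)"
  "runs (prod_encode (3, 0)) x (pfst x)"
  "runs (prod_encode (4, 0)) x (psnd x)"
  "runs (prod_encode (10, 0)) x x"
  by (rule runs_by_step, simp add: mstep_def steps_0)+

lemma runs_seq:
  assumes "runs p x y" "runs q y z"
  shows "runs (prod_encode (5, prod_encode (p, q))) x z"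
  by (rule runs_by_step) (simp add: mstep_def, intro runs_trans[OF assms(1)] runs_trans[OF assms(2)] steps_0)

text \<open>Tag 6 saves \<open>q\<close> and the input \<open>x\<close> in a tag 8 instruction below
  \<open>p\<close>. Once \<open>p\<close> has produced \<open>y\<close>, tag 8 saves
  \<open>y\<close> under tag 9 and restores \<open>x\<close> for \<open>q\<close>; tag 9 finally
  forms the pair.\<close>

lemma runs_pair:
  assumes "runs p x y" "runs q x z"
  shows "runs (prod_encode (6, prod_encode (p, q))) x (prod_encode (y, z))"
proof (rule runs_by_step)
  fix R
  let ?c = "\<lambda>K v. prod_encode (K, v)"
  let ?d = "prod_encode (R, prod_encode (y, z))"
  let ?i8 = "prod_encode (8, prod_encode (q, x))" and ?i9 = "prod_encode (9, y)"
  \<comment> \<open>The execution is assembled from its last instruction back to its first.\<close>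
  have "\<exists>t. (mstep ^^ t) (?c (lcons ?i9 R) z) = ?d"
    by (rule steps_Suc) (simp add: mstep_def steps_0)
  then have "\<exists>t. (mstep ^^ t) (?c (lcons q (lcons ?i9 R)) x) = ?d"
    by (rule runs_trans[OF assms(2)])
  then have "\<exists>t. (mstep ^^ t) (?c (lcons ?i8 R) y) = ?d"
    by (intro steps_Suc[of "?c (lcons ?i8 R) y"]) (simp add: mstep_def)
  then have "\<exists>t. (mstep ^^ t) (?c (lcons p (lcons ?i8 R)) x) = ?d"
    by (rule runs_trans[OF assms(1)])
  then show "\<exists>t. (mstep ^^ t) (mstep (?c (lcons (prod_encode (6, prod_encode (p, q))) R) x)) = ?d"
    by (simp add: mstep_def)
qed

text \<open>In each round the loop instruction pushes its body and itself again. The induction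
  splits off the first round, so it needs the shifted sequence and hence a general
  \<open>s\<close>.\<close>

lemma runs_while:
  assumes "\<And>j. j < k \<Longrightarrow> pfst (s j) \<noteq> 0 \<and> runs p (s j) (s (Suc j))" "pfst (s k) = 0"
  shows "runs (prod_encode (7, p)) (s 0) (s k)"
  using assms
proof (induction k arbitrary: s)
  case 0
  then show ?case by (intro runs_by_step) (simp add: mstep_def steps_0)
next
  case (Suc k)
  have IH: "runs (prod_encode (7, p)) (s 1) (s (Suc k))"
    using Suc.IH[of "\<lambda>j. s (Suc j)"] Suc.prems by simp
  have "pfst (s 0) \<noteq> 0" "runs p (s 0) (s 1)" using Suc.prems(1)[of 0] by auto
  then show ?case
    by (intro runs_by_step) (simp add: mstep_def, intro runs_trans[OF _ runs_trans[OF IH]] steps_0, simp)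
qed

text \<open>Only completeness is needed: a machine that does not come from a recursive function does
  no harm in the enumeration below.\<close>

definition iseq (infixr ";;" 60) where "p ;; q = prod_encode (5, prod_encode (p, q))"
definition ipair where "ipair p q = prod_encode (6, prod_encode (p, q))"
definition iwhile where "iwhile p = prod_encode (7, p)"
definition "izero = prod_encode (0, 0)"
definition "isuc = prod_encode (1, 0)"
definition "ipred = prod_encode (2, 0)"
definition "ifst = prod_encode (3, 0)"
definition "isnd = prod_encode (4, 0)"
definition "iid = prod_encode (10, 0)"

lemma runs_izero: "runs izero x 0"
  and runs_isuc: "runs isuc x (Suc x)"
  and runs_ipred: "runs ipred x (x - 1)"
  and runs_ifst: "runs ifst (prod_encode (a, b)) a"
  and runs_isnd: "runs isnd (prod_encode (a, b)) b"
  and runs_iid: "runs iid x x"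
  using runs_basic[of x] runs_basic[of "prod_encode (a, b)"]
  by (simp_all add: izero_def isuc_def ipred_def ifst_def isnd_def iid_def)

lemma runs_iseq: "runs p x y \<Longrightarrow> runs q y z \<Longrightarrow> runs (p ;; q) x z"
  unfolding iseq_def by (rule runs_seq)

lemma runs_ipair: "runs p x y \<Longrightarrow> runs q x z \<Longrightarrow> runs (ipair p q) x (prod_encode (y, z))"
  unfolding ipair_def by (rule runs_pair)

lemma runs_icons:
  "runs p x y \<Longrightarrow> runs q x (list_encode ys) \<Longrightarrow> runs (ipair p q ;; isuc) x (list_encode (y # ys))"
  unfolding list_encode.simps by (rule runs_iseq[OF runs_ipair runs_isuc])

lemma runs_ihd: "runs (ipred ;; ifst) (list_encode (x # xs)) x"
  by (rule runs_iseq[OF runs_ipred]) (simp add: runs_ifst)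

lemma runs_itl: "runs (ipred ;; isnd) (list_encode (x # xs)) (list_encode xs)"
  by (rule runs_iseq[OF runs_ipred]) (simp add: runs_isnd)

declare list_encode.simps(2) [simp del]

section \<open>Compilation of partial recursive functions into programs\<close>

definition implements :: "nat \<Rightarrow> nat \<Rightarrow> (nat list \<Rightarrow> nat option) \<Rightarrow> bool" where
  "implements p n f \<longleftrightarrow> (\<forall>xs v. length xs = n \<longrightarrow> f xs = Some v \<longrightarrow> runs p (list_encode xs) v)"

text \<open>The program takes \<open>i\<close> tails and then a head. It is chosen before the arity
  because the induction step passes to a shorter list.\<close>

lemma implements_proj: "\<exists>p. \<forall>n > i. implements p n (\<lambda>xs. Some (xs ! i))"
proof (induction i)
  case 0
  show ?case
    by (rule exI[of _ "ipred ;; ifst"])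
      (auto simp: implements_def length_Suc_conv gr0_conv_Suc intro!: runs_ihd)
next
  case (Suc i)
  then obtain p where p: "\<And>n. i < n \<Longrightarrow> implements p n (\<lambda>xs. Some (xs ! i))" by blast
  have "runs ((ipred ;; isnd) ;; p) (list_encode xs) (xs ! Suc i)" if "Suc i < length xs" for xs
  proof (cases xs)
    case (Cons x ys)
    then have "runs p (list_encode ys) (ys ! i)" using p[of "length ys"] that by (simp add: implements_def)
    then show ?thesis unfolding Cons using runs_iseq[OF runs_itl] by simp
  qed (use that in simp)
  then show ?case unfolding implements_def by blast
qed

lemma implements_list:
  assumes "\<And>g. g \<in> set gs \<Longrightarrow> \<exists>p. implements p n g"
  shows "\<exists>p. \<forall>xs. length xs = n \<longrightarrow> (\<forall>g\<in>set gs. g xs \<noteq> None) \<longrightarrow>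
    runs p (list_encode xs) (list_encode (map (\<lambda>g. the (g xs)) gs))"
  using assms
proof (induction gs)
  case Nil
  then show ?case by (intro exI[of _ izero]) (simp add: runs_izero)
next
  case (Cons g gs)
  obtain p where p: "implements p n g" using Cons.prems[OF list.set_intros(1)] by blast
  obtain q where q: "\<forall>xs. length xs = n \<longrightarrow> (\<forall>g\<in>set gs. g xs \<noteq> None) \<longrightarrow>
      runs q (list_encode xs) (list_encode (map (\<lambda>g. the (g xs)) gs))"
    using Cons.IH[OF Cons.prems[OF list.set_intros(2)]] by blast
  show ?case
  proof (intro exI[of _ "ipair p q ;; isuc"] allI impI)
    fix xs assume n: "length xs = n" and def: "\<forall>g\<in>set (g # gs). g xs \<noteq> None"
    have "runs p (list_encode xs) (the (g xs))" using p n def unfolding implements_def by simp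
    moreover have "runs q (list_encode xs) (list_encode (map (\<lambda>g. the (g xs)) gs))"
      using q n def by simp
    ultimately show "runs (ipair p q ;; isuc) (list_encode xs)
        (list_encode (map (\<lambda>g. the (g xs)) (g # gs)))"
      unfolding list.map by (rule runs_icons)
  qed
qed

lemma implements_compose:
  assumes "implements p (length gs) f" "\<And>g. g \<in> set gs \<Longrightarrow> \<exists>p. implements p n g"
  shows "\<exists>p. implements p n (compose f gs)"
proof -
  obtain q where "\<forall>xs. length xs = n \<longrightarrow> (\<forall>g\<in>set gs. g xs \<noteq> None) \<longrightarrow>
    runs q (list_encode xs) (list_encode (map (\<lambda>g. the (g xs)) gs))"
    using implements_list[OF assms(2)] by blast
  with assms(1) have "implements (q ;; p) n (compose f gs)"
    unfolding implements_def compose_def by (auto split: if_splits intro!: runs_iseq)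
  then show ?thesis ..
qed

text \<open>A value at \<open>k\<close> forces values at all smaller indices, so a loop counting
  upwards to \<open>k\<close> never meets an undefined value.\<close>

lemma prec_Some_le:
  "prec f g (k # xs) \<noteq> None \<Longrightarrow> j \<le> k \<Longrightarrow> prec f g (j # xs) \<noteq> None"
  by (induction k) (auto simp: le_Suc_eq split: option.splits)

lemma implements_prec:
  assumes p: "implements p n f" and q: "implements q (n + 2) g"
  shows "\<exists>r. implements r (Suc n) (prec f g)"
proof -
  text \<open>The loop works on tuples \<open>(remaining, index, value, parameters)\<close>.\<close>
  let ?hd = "ipred ;; ifst" and ?tl = "ipred ;; isnd"
  let ?init = "ipair ?hd (ipair izero (ipair (?tl ;; p) ?tl))"
  let ?i = "isnd ;; ifst" and ?v = "isnd ;; isnd ;; ifst" and ?xs = "isnd ;; isnd ;; isnd"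
  let ?args = "ipair ?i (ipair ?v ?xs ;; isuc) ;; isuc"
  let ?body = "ipair (ifst ;; ipred) (ipair (?i ;; isuc) (ipair (?args ;; q) ?xs))"
  have "runs (?init ;; iwhile ?body ;; ?v) (list_encode ys) w"
    if len: "length ys = Suc n" and w: "prec f g ys = Some w" for ys w
  proof -
    obtain k xs where ys: "ys = k # xs" and n: "length xs = n"
      using len by (cases ys) auto
    define u where "u j = the (prec f g (j # xs))" for j
    have u: "prec f g (j # xs) = Some (u j)" if "j \<le> k" for j
      using prec_Some_le[of f g k xs j] w that by (simp add: ys u_def)
    define s where "s j = prod_encode (k - j, prod_encode (j, prod_encode (u j, list_encode xs)))" for j
    have "f xs = Some (u 0)" using u[of 0] by simp
    then have "runs p (list_encode xs) (u 0)" using p n by (simp add: implements_def)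
    then have init: "runs ?init (list_encode (k # xs)) (s 0)"
      unfolding s_def diff_zero
      by (intro runs_ipair runs_ihd runs_izero runs_iseq[OF runs_itl] runs_itl)
    have body: "pfst (s j) \<noteq> 0 \<and> runs ?body (s j) (s (Suc j))" if "j < k" for j
    proof
      show "pfst (s j) \<noteq> 0" using that by (simp add: s_def)
      have "g (j # u j # xs) = Some (u (Suc j))" using u[of j] u[of "Suc j"] that by simp
      then have q': "runs q (list_encode (j # u j # xs)) (u (Suc j))"
        using q n unfolding implements_def by simp
      \<comment> \<open>Brings the new counter into the form computed by
        \<open>ipred\<close>.\<close>
      have "k - Suc j = k - j - 1" by simp
      then show "runs ?body (s j) (s (Suc j))"
        unfolding s_def
        by (simp only:) (intro runs_ipair runs_iseq[OF runs_ifst runs_ipred] runs_iseq[OF _ runs_isuc]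
            runs_iseq[OF _ q'] runs_icons runs_iseq[OF runs_isnd] runs_ifst runs_isnd)
    qed
    have loop: "runs (iwhile ?body) (s 0) (s k)"
      unfolding iwhile_def by (rule runs_while) (use body in \<open>auto simp: s_def\<close>)
    have "w = u k" using w u[of k] ys by simp
    then have "runs ?v (s k) w"
      unfolding s_def by (simp only:) (intro runs_iseq[OF runs_isnd] runs_ifst)
    then show ?thesis unfolding ys by (intro runs_iseq[OF init] runs_iseq[OF loop])
  qed
  then show ?thesis unfolding implements_def by blast
qed

lemma implements_mu:
  assumes p: "implements p (Suc n) f"
  shows "\<exists>r. implements r n (mu f)"
proof -
  text \<open>The loop works on tuples \<open>(f (k # xs), k, xs)\<close>.\<close>
  let ?init = "ipair ((ipair izero iid ;; isuc) ;; p) (ipair izero iid)"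
  let ?k = "(isnd ;; ifst) ;; isuc" and ?xs = "isnd ;; isnd"
  let ?body = "ipair ((ipair ?k ?xs ;; isuc) ;; p) (ipair ?k ?xs)"
  have "runs (?init ;; iwhile ?body ;; isnd ;; ifst) (list_encode xs) k"
    if n: "length xs = n" and k: "mu f xs = Some k" for xs k
  proof -
    define P where "P k \<longleftrightarrow> f (k # xs) = Some 0 \<and> (\<forall>j<k. f (j # xs) \<noteq> None)" for k
    have "mu f xs = (if \<exists>k. P k then Some (LEAST k. P k) else None)"
      unfolding P_def by (rule mu_def)
    then have ex: "\<exists>k. P k" and keq: "k = (LEAST k. P k)"
      using k by (auto split: if_splits)
    have "P k" unfolding keq by (rule LeastI_ex[OF ex])
    then have Pk: "f (k # xs) = Some 0" "\<And>j. j < k \<Longrightarrow> f (j # xs) \<noteq> None"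
      by (auto simp: P_def)
    have least: "\<not> P j" if "j < k" for j
      using that unfolding keq by (rule not_less_Least)
    define u where "u j = the (f (j # xs))" for j
    have u: "f (j # xs) = Some (u j)" if "j \<le> k" for j
      using Pk(1) Pk(2)[of j] that unfolding u_def by (cases "j = k") auto
    \<comment> \<open>A zero at \<open>j < k\<close> would satisfy \<open>P\<close>, all earlier
      values being defined, against minimality of \<open>k\<close>; so the loop does not stop
      early.\<close>
    have pos: "u j \<noteq> 0" if "j < k" for j
      using least[OF that] u[of j] Pk(2) that unfolding P_def by force
    have pu: "runs p (list_encode (j # xs)) (u j)" if "j \<le> k" for j
      using p n u[OF that] unfolding implements_def by simp
    define s where "s j = prod_encode (u j, prod_encode (j, list_encode xs))" for j
    have init: "runs ?init (list_encode xs) (s 0)"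
      unfolding s_def
      by (intro runs_ipair runs_iseq[OF _ pu] runs_icons runs_izero runs_iid) simp
    have body: "pfst (s j) \<noteq> 0 \<and> runs ?body (s j) (s (Suc j))" if "j < k" for j
    proof
      show "pfst (s j) \<noteq> 0" using pos[OF that] by (simp add: s_def)
      show "runs ?body (s j) (s (Suc j))"
        unfolding s_def using that
        by (intro runs_ipair runs_iseq[OF _ pu] runs_icons runs_iseq[OF _ runs_isuc]
            runs_iseq[OF runs_isnd] runs_ifst runs_isnd) simp
    qed
    have loop: "runs (iwhile ?body) (s 0) (s k)"
      unfolding iwhile_def by (rule runs_while) (use body u[of k] Pk(1) in \<open>auto simp: s_def\<close>)
    have "runs (isnd ;; ifst) (s k) k"
      unfolding s_def by (intro runs_iseq[OF runs_isnd] runs_ifst)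
    then show ?thesis by (intro runs_iseq[OF init] runs_iseq[OF loop])
  qed
  then show ?thesis unfolding implements_def by blast
qed

lemma recfn_implements: "recfn n f \<Longrightarrow> \<exists>p. implements p n f"
proof (induction rule: recfn.induct)
  case rf_zero
  show ?case by (intro exI[of _ izero]) (simp add: implements_def runs_izero)
next
  case rf_succ
  have "runs ((ipred ;; ifst) ;; isuc) (list_encode (x # xs)) (Suc x)" for x xs
    by (intro runs_iseq[OF runs_ihd runs_isuc])
  then show ?case by (intro exI) (auto simp: implements_def length_Suc_conv)
next
  case (rf_proj i n)
  then show ?case using implements_proj by blast
next
  case (rf_comp m f gs n)
  then show ?case using implements_compose by blast
next
  case (rf_prec n f g)
  then show ?case using implements_prec by blast
next
  case (rf_mu n f)
  then show ?case using implements_mu by blast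
next
  case (rf_ext n f g)
  then show ?case by (simp add: implements_def)
qed

text \<open>The initial stack holds only \<open>p\<close>, and \<open>lcons z 0\<close> codes the
  argument list \<open>[z]\<close>. An empty stack, coded by 0, signals halting.\<close>

definition sim :: "nat \<Rightarrow> nat \<Rightarrow> nat \<Rightarrow> nat" where
  "sim p z t = (mstep ^^ t) (prod_encode (lcons p 0, lcons z 0))"

lemma trec_sim:
  assumes "0 < n" "trec n P" "trec n Z" "trec n T"
  shows "trec n (\<lambda>xs. sim (P xs) (Z xs) (T xs))"
  unfolding sim_def
  by (intro trec_funpow trec_mstep trec_intros assms) simp

lemma sim_halted:
  assumes "pfst (sim p z t) = 0" "t \<le> t'"
  shows "sim p z t' = sim p z t"
  using assms(2)
proof (induction t' rule: nat_induct_at_least)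
  case (Suc t')
  then show ?case using assms(1) by (simp add: sim_def mstep_def)
qed simp

lemma sim_complete:
  assumes "recfn 1 r"
  obtains p where "\<And>z v. r [z] = Some v \<Longrightarrow> \<exists>t. sim p z t = prod_encode (0, v)"
proof -
  obtain p where "implements p 1 r" using recfn_implements[OF assms] ..
  then have "r [z] = Some v \<Longrightarrow> runs p (list_encode [z]) v" for z v
    unfolding implements_def by simp
  then have "r [z] = Some v \<Longrightarrow> \<exists>t. sim p z t = prod_encode (0, v)" for z v
    unfolding runs_def sim_def by (simp add: list_encode_Cons)
  with that show thesis by blast
qed

section \<open>Codes of tuples\<close>

lemma code_Nil: "code [] = 0"
  by (simp add: code_def)

lemma code_Cons: "code (x # xs) = lcons (code_val x) (code xs)"
  by (simp add: code_def list_encode_Cons)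

text \<open>Replaces the time coordinate in the code of a tuple. As \<open>m\<close> is a fixed
  length, this is a finite composition of heads, tails and conses, not a recursion on codes.\<close>

fun set_last :: "nat \<Rightarrow> nat \<Rightarrow> nat \<Rightarrow> nat" where
  "set_last 0 c t = lcons (prod_encode (0, t)) 0"
| "set_last (Suc m) c t = lcons (lhd c) (set_last m (ltl c) t)"

lemma set_last_code: "length xs = m \<Longrightarrow> set_last m (code (xs @ ys)) t = code (xs @ [VN t])"
  by (induction xs arbitrary: m) (auto simp: code_Cons code_Nil)

lemma trec_set_last:
  assumes "0 < n" "trec n C" "trec n T"
  shows "trec n (\<lambda>xs. set_last m (C xs) (T xs))"
  using assms(2)
proof (induction m arbitrary: C)
  case 0
  show ?case unfolding set_last.simps by (intro trec_intros assms)
next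
  case (Suc m)
  then show ?case unfolding set_last.simps by (intro trec_lcons trec_lhd trec_ltl Suc)
qed

lemma trec_ltl_funpow: "trec n C \<Longrightarrow> trec n (\<lambda>xs. (ltl ^^ m) (C xs))"
  by (induction m) (simp_all add: trec_ltl)

lemma ltl_funpow_code: "length xs = m \<Longrightarrow> (ltl ^^ m) (code (xs @ ys)) = code ys"
  by (induction xs arbitrary: m) (auto simp: code_Cons funpow_swap1)

lemma bspace_length: "x \<in> bspace X \<Longrightarrow> length x = length X"
  by (simp add: bspace_def list_all2_lengthD)

lemma in_comp_CN: "in_comp CN v \<longleftrightarrow> (\<exists>n. v = VN n)"
  by (cases v) auto

lemma bspace_CN_Cons: "y \<in> bspace (CN # X) \<longleftrightarrow> (\<exists>n x. y = VN n # x \<and> x \<in> bspace X)"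
  by (auto simp: bspace_def list_all2_Cons1 in_comp_CN)

lemma bspace_snoc_CN: "y \<in> bspace (Y @ [CN]) \<longleftrightarrow> (\<exists>x t. y = x @ [VN t] \<and> x \<in> bspace Y)"
proof
  assume "y \<in> bspace (Y @ [CN])"
  then show "\<exists>x t. y = x @ [VN t] \<and> x \<in> bspace Y"
    by (auto simp: bspace_def list_all2_append1 list_all2_Cons1 in_comp_CN)
next
  assume "\<exists>x t. y = x @ [VN t] \<and> x \<in> bspace Y"
  then show "y \<in> bspace (Y @ [CN])"
    by (auto simp: bspace_def intro!: list_all2_appendI)
qed

section \<open>Maxima of monotone sequences\<close>

text \<open>A finite range is already attained on a finite set \<open>C\<close> of times, and by
  monotonicity the value at \<open>Max C\<close> dominates all the others.\<close>

lemma mono_range_has_max: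
  assumes "\<And>t t'. t \<le> t' \<Longrightarrow> F t = F t' \<or> lt (F t) (F t')" "finite (range (F :: nat \<Rightarrow> 'd))"
  obtains m where "m \<in> range F" "\<And>s. s \<in> range F \<Longrightarrow> s = m \<or> lt s m"
proof -
  obtain C where C: "finite C" "range F = F ` C"
    using finite_subset_image[OF assms(2) order_refl] by metis
  then have "C \<noteq> {}" by auto
  have "s = F (Max C) \<or> lt s (F (Max C))" if "s \<in> range F" for s
    using that C(1) assms(1) unfolding C(2) by (auto intro: Max_ge)
  with that show thesis by blast
qed

text \<open>Irreflexivity and transitivity make the element described by \<open>THE\<close>
  unique.\<close>

lemma maxf_eq_Some:
  assumes "comp_poset lt \<rho>" "y \<in> bspace Y" "finite (range (\<lambda>t. f (y @ [VN t])))"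
    and "m \<in> range (\<lambda>t. f (y @ [VN t]))"
    and "\<And>s. s \<in> range (\<lambda>t. f (y @ [VN t])) \<Longrightarrow> s = m \<or> lt s m"
  shows "maxf lt Y f y = Some m"
proof -
  let ?S = "range (\<lambda>t. f (y @ [VN t]))"
  have irr: "\<And>d. \<not> lt d d" and tr: "\<And>a b c. lt a b \<Longrightarrow> lt b c \<Longrightarrow> lt a c"
    using assms(1) unfolding comp_poset_def by blast+
  have "(THE m. m \<in> ?S \<and> (\<forall>s\<in>?S. s = m \<or> lt s m)) = m"
  proof (rule the_equality)
    show "m \<in> ?S \<and> (\<forall>s\<in>?S. s = m \<or> lt s m)" using assms(4,5) by blast
    show "k = m" if "k \<in> ?S \<and> (\<forall>s\<in>?S. s = k \<or> lt s k)" for k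
    proof -
      have "m = k \<or> lt m k" "k = m \<or> lt k m" using that assms(4,5) by blast+
      then show ?thesis using irr tr by blast
    qed
  qed
  then show ?thesis using assms(2,3) unfolding maxf_def Let_def by simp
qed

text \<open>Adding the least element to a non-empty range changes neither its finiteness nor its
  maximum, so an enumeration may start from \<open>b\<close>.\<close>

lemma maxf_cong_insert:
  assumes po: "comp_poset lt \<rho>" and g: "mono_last lt Y g"
    and least: "\<And>d. d \<noteq> b \<Longrightarrow> lt b d"
    and range: "\<And>y. y \<in> bspace Y \<Longrightarrow>
      range (\<lambda>t. f (y @ [VN t])) = insert b (range (\<lambda>t. g (y @ [VN t])))"
  shows "maxf lt Y f = maxf lt Y g"
proof
  fix y
  show "maxf lt Y f y = maxf lt Y g y"
  proof (cases "y \<in> bspace Y \<and> finite (range (\<lambda>t. g (y @ [VN t])))")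
    case True
    let ?R = "range (\<lambda>t. g (y @ [VN t]))"
    obtain m where m: "m \<in> ?R" "\<And>s. s \<in> ?R \<Longrightarrow> s = m \<or> lt s m"
      using mono_range_has_max[of "\<lambda>t. g (y @ [VN t])" lt] g True unfolding mono_last_def by blast
    have "maxf lt Y g y = Some m"
      using True m by (intro maxf_eq_Some[OF po]) auto
    moreover have "maxf lt Y f y = Some m"
    proof (intro maxf_eq_Some[OF po], unfold range[OF conjunct1[OF True]])
      show "s = m \<or> lt s m" if "s \<in> insert b ?R" for s
        using that m(2) least[of m] by blast
    qed (use True m in auto)
    ultimately show ?thesis by simp
  next
    case False
    moreover have "finite (range (\<lambda>t. f (y @ [VN t]))) \<longleftrightarrow> finite (range (\<lambda>t. g (y @ [VN t])))"
      if "y \<in> bspace Y"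
      unfolding range[OF that] by simp
    ultimately show ?thesis unfolding maxf_def Let_def by (metis (lifting))
  qed
qed

section \<open>Enumeration of the monotone computable functions\<close>

text \<open>The state \<open>(s, d)\<close> records the least argument \<open>s\<close> not yet treated and the current value
  \<open>d\<close>. A value that would violate monotonicity blocks the process forever.\<close>

definition astep :: "(nat \<Rightarrow> nat) \<Rightarrow> nat \<Rightarrow> nat \<Rightarrow> nat \<Rightarrow> nat \<Rightarrow> nat \<Rightarrow> nat" where
  "astep L m p c t s =
     (let w = sim p (set_last m c (pfst s)) t; s' = prod_encode (Suc (pfst s), psnd w) in
      if pfst w = 0
      then if psnd s = psnd w then s'
           else if L (prod_encode (psnd s, psnd w)) = 1 then s' else s
      else s)"

text \<open>The recursion index doubles as the time bound of the simulation, so a pending argument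
  is retried with ever larger bounds.\<close>

definition approx :: "(nat \<Rightarrow> nat) \<Rightarrow> nat \<Rightarrow> nat \<Rightarrow> nat \<Rightarrow> nat \<Rightarrow> nat \<Rightarrow> nat" where
  "approx L b m p c t = rec_nat (prod_encode (0, b)) (\<lambda>t s. astep L m p c t s) t"

lemma approx_simps [simp]:
  "approx L b m p c 0 = prod_encode (0, b)"
  "approx L b m p c (Suc t) = astep L m p c t (approx L b m p c t)"
  by (simp_all add: approx_def)

lemma trec_approx:
  assumes L: "trec 1 (\<lambda>xs. L (xs ! 0))" and "trec n P" "trec n C" "trec n T"
  shows "trec n (\<lambda>xs. approx L b m (P xs) (C xs) (T xs))"
proof -
  \<comment> \<open>\<open>p\<close> and \<open>c\<close> travel as one packed parameter.\<close>
  have "trec 3 (\<lambda>xs. astep L m (pfst (xs ! 2)) (psnd (xs ! 2)) (xs ! 0) (xs ! 1))"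
    unfolding astep_def Let_def
    by (intro trec_intros trec_comp1[OF L] trec_sim trec_set_last) simp_all
  from trec_rec[OF _ this assms(4) trec_prod_encode[OF assms(2,3)], of "\<lambda>_. prod_encode (0, b)"]
  show ?thesis by (simp add: approx_def trec_const)
qed

context
  fixes lt :: "'d \<Rightarrow> 'd \<Rightarrow> bool" and \<rho> :: "nat \<Rightarrow> 'd" and L :: "nat \<Rightarrow> nat"
  assumes po: "comp_poset lt \<rho>"
    and L: "\<And>k l. L (prod_encode (k, l)) = (if lt (\<rho> k) (\<rho> l) then 1 else 0)"
begin

text \<open>This holds for every \<open>p\<close>, whatever it computes: the current value changes
  only when \<open>L\<close> certifies an increase.\<close>

lemma approx_mono:
  assumes "t \<le> t'"
  shows "\<rho> (psnd (approx L b m p c t)) = \<rho> (psnd (approx L b m p c t')) \<or>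
    lt (\<rho> (psnd (approx L b m p c t))) (\<rho> (psnd (approx L b m p c t')))"
proof -
  define e where "e t = \<rho> (psnd (approx L b m p c t))" for t
  have tr: "\<And>a b c. lt a b \<Longrightarrow> lt b c \<Longrightarrow> lt a c"
    using po unfolding comp_poset_def by blast
  have step: "e (Suc t) = e t \<or> lt (e t) (e (Suc t))" for t
    by (auto simp: e_def astep_def Let_def L)
  have "e t = e t' \<or> lt (e t) (e t')"
    using assms
  proof (induction t' rule: nat_induct_at_least)
    case (Suc t')
    then show ?case using step[of t'] tr[of "e t" "e t'" "e (Suc t')"] by auto
  qed simp
  then show ?thesis by (simp add: e_def)
qed

text \<open>When all simulations halt and \<open>G\<close> is increasing, no value is rejected and
  every argument is eventually treated.\<close>

lemma approx_range:
  assumes least: "\<And>d. d \<noteq> \<rho> b \<Longrightarrow> lt (\<rho> b) d"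
    and halt: "\<And>s. \<exists>t. sim p (set_last m c s) t = prod_encode (0, G s)"
    and mono: "\<And>s s'. s \<le> s' \<Longrightarrow> \<rho> (G s) = \<rho> (G s') \<or> lt (\<rho> (G s)) (\<rho> (G s'))"
  shows "range (\<lambda>t. \<rho> (psnd (approx L b m p c t))) = insert (\<rho> b) (range (\<lambda>s. \<rho> (G s)))"
proof -
  let ?A = "approx L b m p c"
  \<comment> \<open>The current value while \<open>s\<close> is the next argument: the start value
    \<open>b\<close>, then the outputs shifted by one.\<close>
  define val where "val s = (case s of 0 \<Rightarrow> b | Suc s \<Rightarrow> G s)" for s
  have \<rho>: "\<rho> k = \<rho> l \<longleftrightarrow> k = l" for k l
    using po unfolding comp_poset_def by (meson bij_is_inj inj_eq)
  \<comment> \<open>Two halting runs on the same input agree at any later common time bound.\<close>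
  have sound: "psnd (sim p (set_last m c s) t) = G s"
    if h: "pfst (sim p (set_last m c s) t) = 0" for s t
  proof -
    obtain t' where t': "sim p (set_last m c s) t' = prod_encode (0, G s)" using halt by blast
    have "sim p (set_last m c s) (max t t') = sim p (set_last m c s) t"
      "sim p (set_last m c s) (max t t') = sim p (set_last m c s) t'"
      using sim_halted[OF h, of "max t t'"] sim_halted[of p "set_last m c s" t' "max t t'"] t'
      by simp_all
    with t' show ?thesis by (metis psnd_encode)
  qed
  have step: "astep L m p c t (prod_encode (s, val s)) =
      (if pfst (sim p (set_last m c s) t) = 0 then prod_encode (Suc s, val (Suc s))
       else prod_encode (s, val s))" for s t
  proof -
    have "val s = G s \<or> lt (\<rho> (val s)) (\<rho> (G s))"
      using least[of "\<rho> (G s)"] mono[of "s - 1" s] by (cases s) (auto simp: val_def \<rho>)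
    then show ?thesis using sound[of s t] by (auto simp: astep_def Let_def L val_def)
  qed
  have inv: "\<exists>s. ?A t = prod_encode (s, val s)" for t
  proof (induction t)
    case 0
    show ?case by (rule exI[of _ 0]) (simp add: val_def)
  next
    case (Suc t)
    then show ?case by (auto simp: step)
  qed
  have reach: "\<exists>t. ?A t = prod_encode (s, val s)" for s
  proof (induction s)
    case 0
    show ?case by (rule exI[of _ 0]) (simp add: val_def)
  next
    case (Suc s)
    then obtain t where t: "?A t = prod_encode (s, val s)" ..
    obtain t0 where t0: "sim p (set_last m c s) t0 = prod_encode (0, G s)" using halt by blast
    show ?case
    proof (rule ccontr)
      assume never: "\<nexists>t. ?A t = prod_encode (Suc s, val (Suc s))"
      \<comment> \<open>If \<open>s\<close> were never passed, the state would be frozen from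
        \<open>t\<close> on; but once the bound also reaches \<open>t0\<close>, the simulation has
        halted and the state advances.\<close>
      have stay: "?A t' = prod_encode (s, val s)" if "t \<le> t'" for t'
        using that
      proof (induction t' rule: nat_induct_at_least)
        case (Suc t')
        have "?A (Suc t') \<noteq> prod_encode (Suc s, val (Suc s))" using never by blast
        then show ?case using Suc.IH by (simp add: step split: if_splits)
      qed (rule t)
      have "pfst (sim p (set_last m c s) (max t t0)) = 0"
        using sim_halted[of p "set_last m c s" t0 "max t t0"] t0 by simp
      then have "?A (Suc (max t t0)) = prod_encode (Suc s, val (Suc s))"
        using stay[of "max t t0"] by (simp add: step)
      with never show False by blast
    qed
  qed
  have "range (\<lambda>t. psnd (?A t)) = range val"
  proof (intro equalityI subsetI)
    fix v assume "v \<in> range (\<lambda>t. psnd (?A t))"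
    then obtain t where "v = psnd (?A t)" by blast
    with inv[of t] show "v \<in> range val" by auto
  next
    fix v assume "v \<in> range val"
    then obtain s where "v = val s" by blast
    with reach[of s] show "v \<in> range (\<lambda>t. psnd (?A t))" by (metis psnd_encode rangeI)
  qed
  also have "range val = insert b (range G)"
  proof -
    have "val 0 = b" "\<And>s. val (Suc s) = G s" by (simp_all add: val_def)
    moreover have "range val = insert (val 0) (val ` range Suc)"
      by (metis (no_types, lifting) UNIV_eq_I image_insert insert_iff not0_implies_Suc rangeI)
    ultimately show ?thesis by (simp add: image_image)
  qed
  finally have "\<rho> ` range (\<lambda>t. psnd (?A t)) = \<rho> ` insert b (range G)" by simp
  then show ?thesis by (simp add: image_image)
qed

end

section \<open>Computability of maps on basic spaces\<close>

lemma comp_posetE: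
  assumes "comp_poset lt \<rho>"
  obtains L where "trec 1 (\<lambda>xs. L (xs ! 0))"
    "\<And>k l. L (prod_encode (k, l)) = (if lt (\<rho> k) (\<rho> l) then 1 else 0)"
proof -
  obtain r where r: "recfn 1 r"
    "\<And>k l. r [prod_encode (k, l)] = Some (if lt (\<rho> k) (\<rho> l) then 1 else 0)"
    using assms unfolding comp_poset_def by blast
  define L where "L z = the (r [z])" for z
  \<comment> \<open>Every number codes a pair, so \<open>r\<close> is total.\<close>
  have "r [z] = Some (L z)" for z
    using r(2)[of "pfst z" "psnd z"] by (simp add: L_def pfst_def psnd_def)
  then have "trec 1 (\<lambda>xs. L (xs ! 0))"
    unfolding trec_def by (intro rf_ext[OF r(1)]) (auto simp: length_Suc_conv)
  with that[of L] show thesis using r(2) by (simp add: L_def)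
qed

lemma comp_on_trec:
  assumes "trec 1 (\<lambda>xs. F (xs ! 0))"
  shows "comp_on X (\<lambda>x. F (code x))"
  using assms unfolding comp_on_def trec_def by (intro exI conjI) auto

text \<open>A realizer \<open>r\<close> of \<open>f\<close> is composed with \<open>A\<close>, which
  tracks \<phi> on codes.\<close>

lemma comp_into_compose:
  assumes f: "comp_into \<rho> Y f" and A: "trec 1 (\<lambda>xs. A (xs ! 0))"
    and \<phi>: "\<And>x. x \<in> bspace X \<Longrightarrow> \<phi> x \<in> bspace Y \<and> code (\<phi> x) = A (code x)"
  shows "comp_into \<rho> X (\<lambda>x. f (\<phi> x))"
proof -
  obtain g r where r: "recfn 1 r" "\<And>y. y \<in> bspace Y \<Longrightarrow> r [code y] = Some (g y)"
    and g: "\<And>y. y \<in> bspace Y \<Longrightarrow> f y = \<rho> (g y)"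
    using f unfolding comp_into_def comp_on_def by blast
  have "recfn 1 (compose r [\<lambda>xs. Some (A (xs ! 0))])"
    using r(1) A unfolding trec_def by (intro rf_comp[where m = 1]) auto
  then have "comp_on X (\<lambda>x. g (\<phi> x))"
    unfolding comp_on_def by (intro exI conjI) (use r(2) \<phi> in \<open>auto simp: compose_def, metis\<close>)
  then show ?thesis unfolding comp_into_def using g \<phi> by blast
qed

text \<open>Fixing the first coordinate amounts to consing a constant onto the code. This yields one
  inclusion of the enumeration: every section lies in the class.\<close>

lemma MaxRec_section:
  assumes "E \<in> MaxRec lt \<rho> (CN # X)"
  shows "(\<lambda>x. E (VN n # x)) \<in> MaxRec lt \<rho> X"
proof -
  obtain f where E: "E = maxf lt (CN # X) f" and f: "comp_into \<rho> ((CN # X) @ [CN]) f"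
    and mono: "mono_last lt (CN # X) f"
    using assms unfolding MaxRec_def by blast
  have "trec 1 (\<lambda>xs. lcons (prod_encode (0, n)) (xs ! 0))"
    by (intro trec_intros) simp_all
  with f have "comp_into \<rho> (X @ [CN]) (\<lambda>y. f (VN n # y))"
    by (rule comp_into_compose) (simp add: bspace_CN_Cons code_Cons)
  moreover have "mono_last lt X (\<lambda>y. f (VN n # y))"
    unfolding mono_last_def
  proof (intro ballI allI impI)
    fix x t t' assume "x \<in> bspace X" "(t :: nat) \<le> t'"
    then show "f (VN n # x @ [VN t]) = f (VN n # x @ [VN t']) \<or>
        lt (f (VN n # x @ [VN t])) (f (VN n # x @ [VN t']))"
      using mono[unfolded mono_last_def, rule_format, of "VN n # x" t t']
      by (simp add: bspace_CN_Cons)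
  qed
  moreover have "(\<lambda>x. E (VN n # x)) = maxf lt X (\<lambda>y. f (VN n # y))"
    by (simp add: E maxf_def bspace_CN_Cons fun_eq_iff)
  ultimately show ?thesis unfolding MaxRec_def by blast
qed

lemma least_imp_enumeration:
  assumes po: "comp_poset lt \<rho>" and least: "\<And>d. d \<noteq> b \<Longrightarrow> lt b d"
  shows "\<exists>E. E \<in> MaxRec lt \<rho> (CN # X) \<and> {(\<lambda>x. E (VN n # x)) | n. True} = MaxRec lt \<rho> X"
proof -
  obtain L where L: "trec 1 (\<lambda>xs. L (xs ! 0))"
    "\<And>k l. L (prod_encode (k, l)) = (if lt (\<rho> k) (\<rho> l) then 1 else 0)"
    using comp_posetE[OF po] by blast
  define m where "m = length X"
  obtain b' where b: "b = \<rho> b'" using po unfolding comp_poset_def by (meson bij_pointE)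
  \<comment> \<open>For \<open>c\<close> the code of \<open>(n, x, t)\<close>: the head gives
    \<open>n\<close>, the tail with time reset to 0 gives a code independent of \<open>t\<close>,
    and \<open>m\<close> further tails expose \<open>t\<close>. \<open>psnd\<close> strips the
    component tag.\<close>
  define F where "F c = psnd (approx L b' m (psnd (lhd c)) (set_last m (ltl c) 0)
      (psnd (lhd ((ltl ^^ m) (ltl c)))))" for c
  define f where "f y = \<rho> (F (code y))" for y
  have f: "f (VN n # x @ [VN t]) = \<rho> (psnd (approx L b' m n (code (x @ [VN 0])) t))"
    if "x \<in> bspace X" for n x t
    using bspace_length[OF that]
    by (simp add: f_def F_def m_def code_Cons set_last_code ltl_funpow_code)
  have "trec 1 (\<lambda>xs. F (xs ! 0))"
    unfolding F_def
    by (intro trec_intros trec_approx L(1) trec_set_last trec_ltl_funpow) simp_all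
  then have "comp_into \<rho> ((CN # X) @ [CN]) f"
    unfolding comp_into_def f_def using comp_on_trec by blast
  moreover have "mono_last lt (CN # X) f"
    unfolding mono_last_def
  proof (intro ballI allI impI)
    fix y t t' assume "y \<in> bspace (CN # X)" and t: "(t :: nat) \<le> t'"
    then obtain n x where y: "y = VN n # x" and x: "x \<in> bspace X" unfolding bspace_CN_Cons by blast
    show "f (y @ [VN t]) = f (y @ [VN t']) \<or> lt (f (y @ [VN t])) (f (y @ [VN t']))"
      unfolding y append_Cons f[OF x] by (rule approx_mono[OF po L(2) t])
  qed
  ultimately have E: "maxf lt (CN # X) f \<in> MaxRec lt \<rho> (CN # X)"
    unfolding MaxRec_def by blast
  have "\<exists>n. h = (\<lambda>x. maxf lt (CN # X) f (VN n # x))" if h: "h \<in> MaxRec lt \<rho> X" for h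
  proof -
    obtain k where hk: "h = maxf lt X k" and k: "comp_into \<rho> (X @ [CN]) k" "mono_last lt X k"
      using h unfolding MaxRec_def by blast
    obtain g r where r: "recfn 1 r" "\<And>y. y \<in> bspace (X @ [CN]) \<Longrightarrow> r [code y] = Some (g y)"
      and g: "\<And>y. y \<in> bspace (X @ [CN]) \<Longrightarrow> k y = \<rho> (g y)"
      using k(1) unfolding comp_into_def comp_on_def by blast
    \<comment> \<open>The index of \<open>h\<close> is a program for a realizer of
      \<open>k\<close>.\<close>
    obtain p where p: "\<And>z v. r [z] = Some v \<Longrightarrow> \<exists>t. sim p z t = prod_encode (0, v)"
      using sim_complete[OF r(1)] by blast
    have "maxf lt X (\<lambda>y. f (VN p # y)) = maxf lt X k"
    proof (rule maxf_cong_insert[OF po k(2) least])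
      fix x assume x: "x \<in> bspace X"
      then have x_t: "x @ [VN t] \<in> bspace (X @ [CN])" for t
        unfolding bspace_snoc_CN by blast
      have "range (\<lambda>t. \<rho> (psnd (approx L b' m p (code (x @ [VN 0])) t))) =
          insert (\<rho> b') (range (\<lambda>s. \<rho> (g (x @ [VN s]))))"
      proof (rule approx_range[OF po L(2)])
        show "lt (\<rho> b') d" if "d \<noteq> \<rho> b'" for d using least that b by simp
        show "\<exists>t. sim p (set_last m (code (x @ [VN 0])) s) t = prod_encode (0, g (x @ [VN s]))" for s
          using p[OF r(2)[OF x_t]] bspace_length[OF x] by (simp add: set_last_code m_def)
        show "\<rho> (g (x @ [VN s])) = \<rho> (g (x @ [VN s'])) \<or> lt (\<rho> (g (x @ [VN s]))) (\<rho> (g (x @ [VN s'])))"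
          if "s \<le> s'" for s s'
          using k(2) x that unfolding mono_last_def by (simp add: g[OF x_t, symmetric])
      qed
      then show "range (\<lambda>t. f (VN p # x @ [VN t])) = insert b (range (\<lambda>t. k (x @ [VN t])))"
        by (simp add: f[OF x] g[OF x_t] b)
    qed
    then show ?thesis
      by (intro exI[of _ p]) (simp add: hk maxf_def bspace_CN_Cons fun_eq_iff)
  qed
  then have "{(\<lambda>x. maxf lt (CN # X) f (VN n # x)) | n. True} = MaxRec lt \<rho> X"
    using MaxRec_section[OF E] by blast
  with E show ?thesis by blast
qed

section \<open>Diagonalization\<close>

lemma list_encode_eq_0: "list_encode l = 0 \<longleftrightarrow> l = []"
  by (cases l) (simp_all add: list_encode_Cons)

text \<open>Since \<open>ltl 0 = 0\<close>, further tails of the empty list stay at its code, in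
  agreement with \<open>drop\<close>.\<close>

lemma ltl_funpow_list_encode: "(ltl ^^ j) (list_encode l) = list_encode (drop j l)"
proof (induction j)
  case (Suc j)
  have "prod_encode (0, 0) = 0" by (simp add: prod_encode_def)
  then have "ltl 0 = 0" by (metis diff_0_eq_0 ltl_def psnd_encode)
  then have "ltl (list_encode l) = list_encode (tl l)" for l
    by (cases l) (simp_all add: list_encode_Cons)
  then show ?case using Suc by (simp add: drop_Suc tl_drop)
qed simp

text \<open>The first component suffices: a natural number itself, the code of an integer, or the
  length of a word. Allowing any \<open>ys\<close> makes the value independent of an appended time
  coordinate.\<close>

lemma basic_space_onto_nat:
  assumes "basic_space X"
  obtains N where "trec 1 (\<lambda>xs. N (xs ! 0))" "\<And>n. \<exists>x\<in>bspace X. \<forall>ys. N (code (x @ ys)) = n"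
proof -
  obtain C X' where X: "X = C # X'" using assms unfolding basic_space_def by (cases X) auto
  have "\<exists>v. in_comp D v" for D
  proof (cases D)
    case CN show ?thesis unfolding CN by (rule exI[of _ "VN 0"]) simp
  next
    case CZ show ?thesis unfolding CZ by (rule exI[of _ "VZ 0"]) simp
  next
    case (CW k) show ?thesis unfolding CW by (rule exI[of _ "VW []"]) simp
  qed
  \<comment> \<open>Default values for the remaining components.\<close>
  then obtain e where "\<And>D. in_comp D (e D)" by metis
  then have e: "v # map e X' \<in> bspace X" if "in_comp C v" for v
    using that by (simp add: bspace_def X list_all2_map2 list_all2_same)
  define W where "W c = psnd (lhd c)" for c
  have W: "trec 1 (\<lambda>xs. W (xs ! 0))"
    unfolding W_def by (intro trec_intros) simp
  show thesis
  proof (cases C)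
    case CN
    show thesis
    proof (rule that[OF W])
      show "\<exists>x\<in>bspace X. \<forall>ys. W (code (x @ ys)) = n" for n
        using e[of "VN n"] CN by (intro bexI[of _ "VN n # map e X'"]) (simp_all add: W_def code_Cons)
    qed
  next
    case CZ
    show thesis
    proof (rule that[OF W])
      show "\<exists>x\<in>bspace X. \<forall>ys. W (code (x @ ys)) = n" for n
        using e[of "VZ (int_decode n)"] CZ
        by (intro bexI[of _ "VZ (int_decode n) # map e X'"]) (simp_all add: W_def code_Cons)
    qed
  next
    case (CW k)
    then have "0 < k" using assms by (simp add: basic_space_def X)
    \<comment> \<open>The length of a coded word, as the number of tails needed to empty it. The
      letter 0 exists since \<open>0 < k\<close>, so every length occurs.\<close>
    define M where "M w = (LEAST j. (ltl ^^ j) w = 0)" for w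
    have M: "M (list_encode l) = length l" for l
      unfolding M_def ltl_funpow_list_encode list_encode_eq_0 by (intro Least_equality) simp_all
    have "trec 1 (\<lambda>xs. M (W (xs ! 0)))"
      unfolding M_def
    proof (rule trec_Least[OF _ _ W])
      show "trec 2 (\<lambda>xs. (ltl ^^ (xs ! 0)) (xs ! 1))"
        by (intro trec_funpow trec_intros) simp_all
      show "\<exists>j. (ltl ^^ j) w = 0" for w
        using ltl_funpow_list_encode[of "length (list_decode w)" "list_decode w"]
        by (intro exI[of _ "length (list_decode w)"]) simp
    qed
    then show thesis
    proof (rule that)
      show "\<exists>x\<in>bspace X. \<forall>ys. M (W (code (x @ ys))) = n" for n
        using e[of "VW (replicate n 0)"] CW \<open>0 < k\<close>
        by (intro bexI[of _ "VW (replicate n 0) # map e X'"]) (simp_all add: W_def code_Cons M)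
    qed
  qed
qed

lemma no_least_imp_diagonal:
  assumes X: "basic_space X" and po: "comp_poset lt \<rho>"
    and no_least: "\<And>b. \<exists>d. d \<noteq> b \<and> \<not> lt b d"
    and E: "E \<in> MaxRec lt \<rho> (CN # X)"
  shows "\<exists>h\<in>MaxRec lt \<rho> X. \<forall>n. \<exists>x. E (VN n # x) \<noteq> h x"
proof -
  obtain L where L: "trec 1 (\<lambda>xs. L (xs ! 0))"
    "\<And>k l. L (prod_encode (k, l)) = (if lt (\<rho> k) (\<rho> l) then 1 else 0)"
    using comp_posetE[OF po] by blast
  obtain N where N: "trec 1 (\<lambda>xs. N (xs ! 0))"
    "\<And>n. \<exists>x\<in>bspace X. \<forall>ys. N (code (x @ ys)) = n"
    using basic_space_onto_nat[OF X] by blast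
  obtain f where Ef: "E = maxf lt (CN # X) f" and f: "comp_into \<rho> ((CN # X) @ [CN]) f"
    and mono: "mono_last lt (CN # X) f"
    using E unfolding MaxRec_def by blast
  obtain g where g: "comp_on ((CN # X) @ [CN]) g"
    "\<And>y. y \<in> bspace ((CN # X) @ [CN]) \<Longrightarrow> f y = \<rho> (g y)"
    using f unfolding comp_into_def by blast
  \<comment> \<open>A zero means that \<open>\<rho> v \<le> \<rho> d\<close> fails; such a
    \<open>d\<close> exists because \<open>\<rho> v\<close> is not least.\<close>
  define test where "test d v = (if d = v then 1 else L (prod_encode (v, d)))" for d v
  define D where "D v = (LEAST d. test d v = 0)" for v
  have test: "test d v = 0 \<longleftrightarrow> \<rho> d \<noteq> \<rho> v \<and> \<not> lt (\<rho> v) (\<rho> d)" for d v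
    using po unfolding comp_poset_def test_def L(2) by (auto dest: bij_is_inj injD)
  have ex: "\<exists>d. test d v = 0" for v
    using no_least[of "\<rho> v"] po unfolding test comp_poset_def by (metis bij_pointE)
  have D: "\<rho> (D v) \<noteq> \<rho> v" "\<not> lt (\<rho> v) (\<rho> (D v))" for v
    using LeastI_ex[OF ex[of v], folded D_def] unfolding test by blast+
  have "trec 2 (\<lambda>xs. test (xs ! 0) (xs ! 1))"
    unfolding test_def by (intro trec_intros trec_comp1[OF L(1)]) simp_all
  then have "trec 1 (\<lambda>xs. D (xs ! 0))"
    unfolding D_def by (intro trec_Least ex trec_proj) simp_all
  with g(1) have Dg: "comp_into \<rho> ((CN # X) @ [CN]) (\<lambda>y. \<rho> (D (g y)))"
  proof -
    assume Dt: "trec 1 (\<lambda>xs. D (xs ! 0))" and "comp_on ((CN # X) @ [CN]) g"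
    then obtain r where r: "recfn 1 r" "\<And>y. y \<in> bspace ((CN # X) @ [CN]) \<Longrightarrow> r [code y] = Some (g y)"
      unfolding comp_on_def by blast
    have "recfn 1 (compose (\<lambda>xs. Some (D (xs ! 0))) [r])"
      using r(1) Dt unfolding trec_def by (intro rf_comp[where m = 1]) auto
    then have "comp_on ((CN # X) @ [CN]) (\<lambda>y. D (g y))"
      unfolding comp_on_def by (intro exI conjI) (use r(2) in \<open>auto simp: compose_def\<close>)
    then show ?thesis unfolding comp_into_def by blast
  qed
  \<comment> \<open>Turns the code of \<open>(x, t)\<close> into that of
    \<open>(\<nu> x, x, 0)\<close>, with \<open>N\<close> in the role of \<nu>.\<close>
  define A where "A c = lcons (prod_encode (0, N (set_last (length X) c 0))) (set_last (length X) c 0)" for c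
  have A: "trec 1 (\<lambda>xs. A (xs ! 0))"
    unfolding A_def by (intro trec_intros trec_comp1[OF N(1)] trec_set_last) simp_all
  define \<phi> where "\<phi> x = VN (N (code (x @ [VN 0]))) # x @ [VN 0]" for x
  have \<phi>: "\<phi> x \<in> bspace ((CN # X) @ [CN])" if "x \<in> bspace X" for x
    using that unfolding \<phi>_def append_Cons bspace_CN_Cons bspace_snoc_CN by blast
  \<comment> \<open>\<open>butlast\<close> discards the time, so \<open>k\<close> is constant in it
    and trivially monotone.\<close>
  define k where "k y = \<rho> (D (g (\<phi> (butlast y))))" for y
  have k: "k (x @ [VN t]) = \<rho> (D (g (\<phi> x)))" for x t by (simp add: k_def)
  have "comp_into \<rho> (X @ [CN]) k"
    unfolding k_def
  proof (rule comp_into_compose[OF Dg A])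
    fix y assume "y \<in> bspace (X @ [CN])"
    then obtain x t where y: "y = x @ [VN t]" and x: "x \<in> bspace X"
      unfolding bspace_snoc_CN by blast
    show "\<phi> (butlast y) \<in> bspace ((CN # X) @ [CN]) \<and> code (\<phi> (butlast y)) = A (code y)"
      using \<phi>[OF x] by (simp add: y A_def set_last_code bspace_length[OF x] \<phi>_def code_Cons)
  qed
  then have "maxf lt X k \<in> MaxRec lt \<rho> X"
    unfolding MaxRec_def mono_last_def by (auto simp: k)
  moreover have "\<exists>x. E (VN n # x) \<noteq> maxf lt X k x" for n
  proof -
    obtain x where x: "x \<in> bspace X" and n: "\<And>ys. N (code (x @ ys)) = n" using N(2) by blast
    let ?R = "range (\<lambda>t. f (VN n # x @ [VN t]))"
    have nx: "VN n # x \<in> bspace (CN # X)" using x by (simp add: bspace_CN_Cons)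
    have "maxf lt X k x = Some (\<rho> (D (g (\<phi> x))))"
      using x by (intro maxf_eq_Some[OF po]) (auto simp: k)
    moreover have "E (VN n # x) \<noteq> Some (\<rho> (D (g (\<phi> x))))"
    \<comment> \<open>With a finite range, the maximum \<open>m\<close> lies above
      \<open>f (n, x, 0)\<close> or equals it, which the diagonal value does not; with an infinite
      range, \<open>E\<close> is undefined at this point.\<close>
    proof (cases "finite ?R")
      case True
      obtain m where m: "m \<in> ?R" "\<And>s. s \<in> ?R \<Longrightarrow> s = m \<or> lt s m"
        using mono_range_has_max[of "\<lambda>t. f (VN n # x @ [VN t])" lt] True
          mono[unfolded mono_last_def, rule_format, OF nx, unfolded append_Cons] by blast
      have "E (VN n # x) = Some m"
        unfolding Ef using m True by (intro maxf_eq_Some[OF po nx]) auto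
      moreover have "\<rho> (g (\<phi> x)) = m \<or> lt (\<rho> (g (\<phi> x))) m"
        using m(2)[of "f (VN n # x @ [VN 0])"] g(2)[OF \<phi>[OF x]] by (simp add: \<phi>_def n)
      ultimately show ?thesis using D[of "g (\<phi> x)"] by auto
    qed (simp add: Ef maxf_def)
    ultimately show ?thesis by metis
  qed
  ultimately show ?thesis by blast
qed

theorem mainTheorem7:
  fixes lt :: "'d \<Rightarrow> 'd \<Rightarrow> bool" and \<rho> :: "nat \<Rightarrow> 'd" and X :: "comp list"
  assumes "basic_space X" and "comp_poset lt \<rho>"
  shows "(\<exists>b. \<forall>d. d \<noteq> b \<longrightarrow> lt b d) \<longleftrightarrow>
         (\<exists>E. E \<in> MaxRec lt \<rho> (CN # X) \<and>
              {(\<lambda>x. E (VN n # x)) | n. True} = MaxRec lt \<rho> X)"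
proof
  assume "\<exists>b. \<forall>d. d \<noteq> b \<longrightarrow> lt b d"
  then obtain b where "\<And>d. d \<noteq> b \<Longrightarrow> lt b d" by blast
  then show "\<exists>E. E \<in> MaxRec lt \<rho> (CN # X) \<and> {(\<lambda>x. E (VN n # x)) | n. True} = MaxRec lt \<rho> X"
    by (rule least_imp_enumeration[OF assms(2)])
next
  assume "\<exists>E. E \<in> MaxRec lt \<rho> (CN # X) \<and> {(\<lambda>x. E (VN n # x)) | n. True} = MaxRec lt \<rho> X"
  then obtain E where E: "E \<in> MaxRec lt \<rho> (CN # X)"
    and eq: "{(\<lambda>x. E (VN n # x)) | n. True} = MaxRec lt \<rho> X" by blast
  show "\<exists>b. \<forall>d. d \<noteq> b \<longrightarrow> lt b d"
  proof (rule ccontr)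
    assume "\<nexists>b. \<forall>d. d \<noteq> b \<longrightarrow> lt b d"
    then have "\<exists>d. d \<noteq> b \<and> \<not> lt b d" for b by blast
    then obtain h where h: "h \<in> MaxRec lt \<rho> X" "\<And>n. \<exists>x. E (VN n # x) \<noteq> h x"
      using no_least_imp_diagonal[OF assms _ E] by blast
    from h(1) obtain n where "h = (\<lambda>x. E (VN n # x))" unfolding eq[symmetric] by blast
    with h(2)[of n] show False by simp
  qed
qed

end
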